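(* Let $0<q<p\le1$, let $k$ be a positive integer and $n\ge1$. Then $$C_{n,p,q}^{(k)}(x)=\sum_{m=0}^n(-1)^{n-m}S_1(n,m)\sum_{l=0}^m\binom ml \frac{(-x)^l}{[m-l+1]_{p,q}^k}=\sum_{m=0}^nS_1(n,m,x)\frac{(-1)^{n-m}}{[m+1]_{p,q}^k}.$$
   Context: $[n]_{p,q}=\frac{p^n-q^n}{p-q}$. For $0<q<p\le1$ (so $|p/q|>1$) the $(p,q)$-integral is $\int_0^x f(t)\,d_{p,q}t=(p-q)x\sum_{n=0}^\infty \frac{q^n}{p^{n+1}}f\!\left(\frac{q^n}{p^{n+1}}x\right)$. Let $(y)_n=y(y-1)\cdots(y-n+1)$, $(y)_0=1$. The $(p,q)$-poly-Cauchy polynomials of the first kind are $C_{n,p,q}^{(k)}(x)=\int_0^1\cdots\int_0^1 (t_1\cdots t_k-x)_n\,d_{p,q}t_1\cdots d_{p,q}t_k$ ($k$-fold). The unsigned Stirling numbers of the first kind $S_1(n,m)$ are defined by $x(x+1)\cdots(x+n-1)=\sum_{m=0}^n S_1(n,m)x^m$. The weighted Stirling numbers of the first kind are defined by $\frac{(1-t)^{-x}(-\ln(1-t))^m}{m!}=\sum_{n\ge m}S_1(n,m,x)\frac{t^n}{n!}$. *)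

theory Defs
  imports
    "HOL-Analysis.Analysis"
    "HOL-Combinatorics.Stirling"
    "HOL-Computational_Algebra.Formal_Power_Series"
begin

definition pq_number :: "real \<Rightarrow> real \<Rightarrow> nat \<Rightarrow> real" where
  "pq_number p q n = (p ^ n - q ^ n) / (p - q)"

definition pq_integral ::
  "real \<Rightarrow> real \<Rightarrow> (real \<Rightarrow> 'a::real_normed_vector) \<Rightarrow> real \<Rightarrow> 'a" where
  "pq_integral p q f x =
     ((p - q) * x) *\<^sub>R
       (\<Sum>n. (q ^ n / p ^ (n + 1)) *\<^sub>R f (q ^ n / p ^ (n + 1) * x))"

text \<open>
  The iterated integral over [0,1] in each variable, where the integrand takes the list
  of variables t_1, ..., t_k. The head t_1 is integrated first (innermost), t_k last.
\<close>

primrec pq_multi_integral ::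
  "real \<Rightarrow> real \<Rightarrow> nat \<Rightarrow> (real list \<Rightarrow> 'a::real_normed_vector) \<Rightarrow> 'a" where
  "pq_multi_integral p q 0 F = F []"
| "pq_multi_integral p q (Suc k) F =
     pq_multi_integral p q k (\<lambda>ts. pq_integral p q (\<lambda>t. F (t # ts)) 1)"

definition falling_factorial :: "'a::comm_ring_1 \<Rightarrow> nat \<Rightarrow> 'a" where
  "falling_factorial y n = (\<Prod>i<n. y - of_nat i)"

definition pq_poly_cauchy ::
  "nat \<Rightarrow> real \<Rightarrow> real \<Rightarrow> nat \<Rightarrow> 'a::real_normed_field \<Rightarrow> 'a" where
  "pq_poly_cauchy n p q k x =
     pq_multi_integral p q k (\<lambda>ts. falling_factorial (of_real (prod_list ts) - x) n)"

text \<open>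
  The coefficient of t^n/n! in (1-t)^(-x) (-ln(1-t))^m / m!, as a formal power series in t.
  In the library, \<^term>\<open>fps_binomial a\<close> is (1+t)^a and \<^term>\<open>fps_ln 1\<close> is ln(1+t).
\<close>

definition weighted_stirling :: "nat \<Rightarrow> nat \<Rightarrow> 'a::field_char_0 \<Rightarrow> 'a" where
  "weighted_stirling n m x =
     fact n * fps_nth
       (fps_const (1 / fact m) *
        ((fps_binomial (- x) oo (- fps_X)) * (- (fps_ln 1 oo (- fps_X))) ^ m)) n"

end

theory Submission imports Defs begin

text \<open>
  The \<open>(p,q)\<close>-integral of \<open>t ^ j\<close> over \<open>[0,1]\<close> is a geometric series with sum \<open>1 / [j + 1]\<close>, so the
  \<open>k\<close>-fold integral of a polynomial in \<open>t\<^sub>1 \<cdots> t\<^sub>k\<close> is obtained by replacing \<open>y ^ j\<close> with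
  \<open>1 / [j + 1] ^ k\<close>. The two sums arise from two expansions of \<open>(y - x)\<^sub>n\<close> in powers of \<open>y\<close>: by
  Stirling numbers and the binomial theorem, and by comparing coefficients in
  \<open>(1 - t)\<^bsup>- x - y\<^esup> = (1 - t)\<^bsup>- x\<^esup> exp (- y ln (1 - t))\<close> with \<open>y\<close> replaced by \<open>- y\<close>.
\<close>

lemma scaleR_suminf_unique:
  fixes f :: "nat \<Rightarrow> 'a::real_normed_vector"
  assumes "(\<lambda>n. c *\<^sub>R f n) sums s"
  shows "c *\<^sub>R suminf f = s"
proof (cases "c = 0")
  case True
  with assms show ?thesis by (simp add: sums_iff)
next
  case False
  with sums_scaleR_right[OF assms, of "inverse c"] show ?thesis
    by (simp add: sums_iff)
qed

definition has_pq_integral ::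
  "real \<Rightarrow> real \<Rightarrow> (real \<Rightarrow> 'a::real_normed_vector) \<Rightarrow> real \<Rightarrow> 'a \<Rightarrow> bool" where
  "has_pq_integral p q f x I \<longleftrightarrow>
     (\<lambda>n. ((p - q) * x) *\<^sub>R ((q ^ n / p ^ (n + 1)) *\<^sub>R f (q ^ n / p ^ (n + 1) * x))) sums I"

lemma pq_integral_unique: "has_pq_integral p q f x I \<Longrightarrow> pq_integral p q f x = I"
  unfolding has_pq_integral_def pq_integral_def by (rule scaleR_suminf_unique)

lemma has_pq_integral_linear:
  assumes "has_pq_integral p q f x I" and "bounded_linear h"
  shows "has_pq_integral p q (\<lambda>t. h (f t)) x (h I)"
proof -
  interpret bounded_linear h by fact
  show ?thesis
    using sums[OF assms(1)[unfolded has_pq_integral_def]]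
    by (simp only: has_pq_integral_def scaleR)
qed

lemma has_pq_integral_sum:
  assumes "\<And>i. i \<in> A \<Longrightarrow> has_pq_integral p q (f i) x (I i)"
  shows "has_pq_integral p q (\<lambda>t. \<Sum>i\<in>A. f i t) x (\<Sum>i\<in>A. I i)"
  using assms unfolding has_pq_integral_def scaleR_sum_right by (rule sums_sum)

lemma has_pq_integral_power:
  assumes "\<bar>q\<bar> < \<bar>p\<bar>"
  shows "has_pq_integral p q (\<lambda>t. t ^ j) x (x ^ Suc j / pq_number p q (Suc j))"
proof -
  define r where "r = (q / p) ^ Suc j"
  have "p \<noteq> 0" "p \<noteq> q"
    using assms by auto
  have "\<bar>q / p\<bar> ^ Suc j < 1"
    using assms by (intro power_less_one_iff[THEN iffD2]) auto
  then have "norm r < 1"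
    by (simp add: r_def power_abs del: power_Suc)
  then have "(\<lambda>n. (p - q) * (x / p) ^ Suc j * r ^ n) sums
      ((p - q) * (x / p) ^ Suc j * (1 / (1 - r)))"
    by (intro sums_mult geometric_sums)
  moreover have "(p - q) * (x / p) ^ Suc j * r ^ n =
      ((p - q) * x) *\<^sub>R ((q ^ n / p ^ (n + 1)) *\<^sub>R (q ^ n / p ^ (n + 1) * x) ^ j)" for n
  proof -
    have "(x / p) ^ Suc j * r ^ n = (x / p * (q / p) ^ n) ^ Suc j"
      unfolding r_def power_mult_distrib by (simp only: mult.commute flip: power_mult)
    also have "x / p * (q / p) ^ n = q ^ n / p ^ (n + 1) * x"
      by (simp add: power_divide)
    finally show ?thesis
      by (simp add: mult.assoc del: power_Suc) (simp add: mult_ac)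
  qed
  moreover have "(p - q) * (x / p) ^ Suc j * (1 / (1 - r)) = x ^ Suc j / pq_number p q (Suc j)"
  proof -
    have "p ^ Suc j * (1 - r) = p ^ Suc j - q ^ Suc j"
      using \<open>p \<noteq> 0\<close> by (simp add: r_def power_divide right_diff_distrib del: power_Suc)
    then show ?thesis
      using \<open>p \<noteq> q\<close> by (simp add: pq_number_def power_divide mult_ac del: power_Suc)
  qed
  ultimately show ?thesis
    by (simp add: has_pq_integral_def)
qed

lemma has_pq_integral_polynomial:
  fixes a :: "'i \<Rightarrow> 'a::real_normed_field"
  assumes "\<bar>q\<bar> < \<bar>p\<bar>"
  shows "has_pq_integral p q (\<lambda>t. \<Sum>i\<in>A. a i * of_real t ^ e i) x
           (\<Sum>i\<in>A. a i * of_real (x ^ Suc (e i) / pq_number p q (Suc (e i))))"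
proof (rule has_pq_integral_sum)
  fix i
  have "bounded_linear (\<lambda>r. a i * of_real r)"
    by (intro bounded_linear_const_mult bounded_linear_of_real)
  from has_pq_integral_linear[OF has_pq_integral_power[OF assms] this]
  show "has_pq_integral p q (\<lambda>t. a i * of_real t ^ e i) x
      (a i * of_real (x ^ Suc (e i) / pq_number p q (Suc (e i))))"
    by (simp only: of_real_power)
qed

lemma pq_multi_integral_polynomial:
  fixes a :: "'i \<Rightarrow> 'a::real_normed_field"
  assumes "\<bar>q\<bar> < \<bar>p\<bar>"
  shows "pq_multi_integral p q k (\<lambda>ts. \<Sum>i\<in>A. a i * of_real (prod_list ts) ^ e i) =
           (\<Sum>i\<in>A. a i / of_real (pq_number p q (Suc (e i))) ^ k)"
proof (induction k arbitrary: a)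
  case 0
  show ?case by simp
next
  case (Suc k)
  let ?a = "\<lambda>i. a i / of_real (pq_number p q (Suc (e i)))"
  have "pq_integral p q (\<lambda>t. \<Sum>i\<in>A. a i * of_real (prod_list (t # ts)) ^ e i) 1 =
      (\<Sum>i\<in>A. ?a i * of_real (prod_list ts) ^ e i)" for ts
    using pq_integral_unique[OF has_pq_integral_polynomial[OF assms,
        where a = "\<lambda>i. a i * of_real (prod_list ts) ^ e i" and x = 1]]
    by (simp add: power_mult_distrib mult_ac)
  then show ?case
    using Suc.IH[of ?a] by simp
qed

lemma fps_binomial_conv_fps_exp: "fps_binomial c = fps_exp c oo fps_ln 1"
proof -
  have "fps_deriv (fps_exp c oo fps_ln 1) = fps_const c * (fps_exp c oo fps_ln 1) / (1 + fps_X)"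
    by (simp add: fps_compose_deriv fps_ln_deriv fps_divide_unit fps_const_mult_apply_left)
  then show ?thesis
    by (intro fps_binomial_ODE_unique'[THEN iffD1, symmetric]) simp
qed

lemma fps_nth_mult_compose:
  fixes f g h :: "'a::comm_ring_1 fps"
  assumes "fps_nth g 0 = 0"
  shows "fps_nth (h * (f oo g)) n = (\<Sum>m\<le>n. fps_nth f m * fps_nth (h * g ^ m) n)"
proof -
  have "fps_nth (f oo g) j = (\<Sum>m\<le>n. fps_nth f m * fps_nth (g ^ m) j)" if "j \<le> n" for j
    unfolding fps_compose_nth using that startsby_zero_power_prefix[OF assms]
    by (intro sum.mono_neutral_left) auto
  then have "fps_nth (h * (f oo g)) n =
      (\<Sum>i=0..n. fps_nth h i * (\<Sum>m\<le>n. fps_nth f m * fps_nth (g ^ m) (n - i)))"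
    by (simp add: fps_mult_nth)
  also have "\<dots> = (\<Sum>m\<le>n. \<Sum>i=0..n. fps_nth h i * (fps_nth f m * fps_nth (g ^ m) (n - i)))"
    unfolding sum_distrib_left by (rule sum.swap)
  also have "\<dots> = (\<Sum>m\<le>n. fps_nth f m * fps_nth (h * g ^ m) n)"
    by (simp add: fps_mult_nth sum_distrib_left mult.left_commute)
  finally show ?thesis .
qed

lemma fps_nth_binomial_compose_uminus_X:
  "fps_nth (fps_binomial (- c) oo (- fps_X)) n = pochhammer c n / fact n"
  by (simp add: fps_compose_uminus' gbinomial_pochhammer flip: power_mult_distrib mult.assoc)

lemma weighted_stirling_pochhammer:
  fixes x y :: "'a::field_char_0"
  shows "(\<Sum>m\<le>n. weighted_stirling n m x * y ^ m) = pochhammer (x + y) n"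
proof -
  define B where "B c = fps_binomial (- c) oo (- fps_X)" for c :: 'a
  define L :: "'a fps" where "L = - (fps_ln 1 oo (- fps_X))"
  have "L = (- fps_X) oo (fps_ln 1 oo (- fps_X))"
    by (simp add: L_def fps_compose_uminus)
  then have "fps_exp y oo L = fps_exp (- y) oo (fps_ln 1 oo (- fps_X))"
    by (simp add: fps_compose_assoc)
  also have "\<dots> = B y"
    by (simp add: B_def fps_binomial_conv_fps_exp fps_compose_assoc)
  finally have B_add: "B (x + y) = B x * (fps_exp y oo L)"
    using fps_binomial_add_mult[of "- x" "- y"] by (simp add: B_def fps_compose_mult_distrib)
  have "pochhammer (x + y) n = fact n * fps_nth (B (x + y)) n"
    by (simp only: B_def fps_nth_binomial_compose_uminus_X) simp
  also have "\<dots> = fact n * (\<Sum>m\<le>n. fps_nth (fps_exp y) m * fps_nth (B x * L ^ m) n)"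
    unfolding B_add by (subst fps_nth_mult_compose) (simp_all add: L_def)
  also have "\<dots> = (\<Sum>m\<le>n. weighted_stirling n m x * y ^ m)"
    by (simp add: weighted_stirling_def B_def L_def sum_distrib_left mult_ac)
  finally show ?thesis ..
qed

lemma falling_factorial_conv_pochhammer: "falling_factorial y n = (- 1) ^ n * pochhammer (- y) n"
  by (induction n) (simp_all add: falling_factorial_def pochhammer_Suc algebra_simps)

lemma minus_one_power_mult_sum_uminus_power:
  fixes y :: "'a::comm_ring_1"
  shows "(- 1) ^ n * (\<Sum>m\<le>n. c m * (- y) ^ m) = (\<Sum>m\<le>n. (- 1) ^ (n - m) * c m * y ^ m)"
  unfolding sum_distrib_left
proof (rule sum.cong)
  fix m assume "m \<in> {..n}"
  then have "(- 1 :: 'a) ^ n = (- 1) ^ (n - m) * (- 1) ^ m"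
    by (simp flip: power_add)
  then have "(- 1) ^ n * (c m * (- y) ^ m) = (- 1) ^ (n - m) * c m * ((- 1) ^ m * (- y) ^ m)"
    by (simp only: mult_ac)
  also have "(- 1) ^ m * (- y) ^ m = y ^ m"
    by (simp flip: power_mult_distrib)
  finally show "(- 1) ^ n * (c m * (- y) ^ m) = (- 1) ^ (n - m) * c m * y ^ m" .
qed simp

lemma falling_factorial_conv_stirling:
  "falling_factorial y n = (\<Sum>m\<le>n. (- 1) ^ (n - m) * of_nat (stirling n m) * y ^ m)"
  unfolding falling_factorial_conv_pochhammer stirling_pochhammer[symmetric]
  by (rule minus_one_power_mult_sum_uminus_power)

lemma falling_factorial_diff_conv_weighted_stirling:
  fixes x y :: "'a::field_char_0"
  shows "falling_factorial (y - x) n =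
           (\<Sum>m\<le>n. (- 1) ^ (n - m) * weighted_stirling n m x * y ^ m)"
proof -
  have "falling_factorial (y - x) n = (- 1) ^ n * pochhammer (x + - y) n"
    by (simp add: falling_factorial_conv_pochhammer)
  then show ?thesis
    by (simp only: minus_one_power_mult_sum_uminus_power flip: weighted_stirling_pochhammer)
qed

lemma pq_poly_cauchy_expand:
  fixes a :: "'i \<Rightarrow> 'a::real_normed_field"
  assumes "\<bar>q\<bar> < \<bar>p\<bar>"
    and "\<And>y. falling_factorial (y - x) n = (\<Sum>i\<in>A. a i * y ^ e i)"
  shows "pq_poly_cauchy n p q k x = (\<Sum>i\<in>A. a i / of_real (pq_number p q (Suc (e i))) ^ k)"
  by (simp only: pq_poly_cauchy_def assms(2) pq_multi_integral_polynomial[OF assms(1)])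

lemma pq_poly_cauchy_conv_stirling:
  fixes x :: "'a::real_normed_field"
  assumes "\<bar>q\<bar> < \<bar>p\<bar>"
  shows "pq_poly_cauchy n p q k x =
           (\<Sum>m\<le>n. (- 1) ^ (n - m) * of_nat (stirling n m) *
              (\<Sum>l\<le>m. of_nat (m choose l) * ((- x) ^ l / of_real (pq_number p q (Suc (m - l))) ^ k)))"
proof -
  define a where
    "a = (\<lambda>(m, l). (- 1) ^ (n - m) * of_nat (stirling n m) * (of_nat (m choose l) * (- x) ^ l))"
  have "falling_factorial (y - x) n =
      (\<Sum>(m, l)\<in>(SIGMA m:{..n}. {..m}). a (m, l) * y ^ (m - l))" for y
  proof -
    have "(y - x) ^ m = (\<Sum>l\<le>m. of_nat (m choose l) * (- x) ^ l * y ^ (m - l))" for m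
      using binomial_ring[of "- x" y m] by simp
    then show ?thesis
      by (simp add: falling_factorial_conv_stirling a_def sum_distrib_left mult_ac flip: sum.Sigma)
  qed
  then have "pq_poly_cauchy n p q k x =
      (\<Sum>(m, l)\<in>(SIGMA m:{..n}. {..m}). a (m, l) / of_real (pq_number p q (Suc (m - l))) ^ k)"
    using pq_poly_cauchy_expand[OF assms, where a = a and e = "\<lambda>(m, l). m - l"]
    by (simp add: case_prod_unfold)
  then show ?thesis
    by (simp add: a_def sum_distrib_left mult.assoc flip: sum.Sigma)
qed

lemma pq_poly_cauchy_conv_weighted_stirling:
  fixes x :: "'a::real_normed_field"
  assumes "\<bar>q\<bar> < \<bar>p\<bar>"
  shows "pq_poly_cauchy n p q k x =
           (\<Sum>m\<le>n. weighted_stirling n m x * ((- 1) ^ (n - m) / of_real (pq_number p q (Suc m)) ^ k))"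
  using pq_poly_cauchy_expand[OF assms falling_factorial_diff_conv_weighted_stirling]
  by (simp add: mult_ac)

theorem theorem10:
  fixes p q :: real and k n :: nat and x :: "'a::real_normed_field"
  assumes "0 < q" and "q < p" and "p \<le> 1" and "k \<ge> 1" and "n \<ge> 1"
  shows "pq_poly_cauchy n p q k x =
           (\<Sum>m=0..n. (- 1) ^ (n - m) * of_nat (stirling n m) *
              (\<Sum>l=0..m. of_nat (m choose l) * ((- x) ^ l / of_real (pq_number p q (m - l + 1)) ^ k)))
       \<and> (\<Sum>m=0..n. (- 1) ^ (n - m) * of_nat (stirling n m) *
              (\<Sum>l=0..m. of_nat (m choose l) * ((- x) ^ l / of_real (pq_number p q (m - l + 1)) ^ k))) =
           (\<Sum>m=0..n. weighted_stirling n m x * ((- 1) ^ (n - m) / of_real (pq_number p q (m + 1)) ^ k))"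
proof -
  have "\<bar>q\<bar> < \<bar>p\<bar>"
    using assms(1,2) by simp
  then show ?thesis
    using pq_poly_cauchy_conv_stirling[of q p n k x]
      pq_poly_cauchy_conv_weighted_stirling[of q p n k x]
    by (simp add: atLeast0AtMost)
qed

end
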